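(* Let $n$ and $r$ be positive integers. Then $$h_n[p_r]=\sum_{\beta} \hat{s}_r(\beta)\,h_\beta ,$$ where the sum is over all compositions $\beta$ of $nr$ and $\hat{s}_r(\beta)$ is taken in the composition sense. Moreover, for every partition $\mu$ of $nr$, the coefficient of $h_\mu$ in the expansion of $h_n[p_r]$ in the basis $\{h_\mu\}$ indexed by partitions $\mu$ of $nr$ is $\hat{s}_r(\mu)$, taken in the partition sense.
   Context: $h_n$ is the $n$th complete homogeneous symmetric function in $x_1,x_2,\ldots$ over $\mathbb{Q}$ (with $h_0=1$), $p_r=\sum_i x_i^r$, and $h_n[p_r]$ denotes plethysm, i.e. $h_n[p_r](x_1,x_2,\ldots)=h_n(x_1^r,x_2^r,\ldots)$. A composition of $m$ is a finite list $\beta=(\beta_1,\ldots,\beta_l)$ of positive integers with sum $m$, of length $\ell(\beta)=l$; $h_\beta=h_{\beta_1}\cdots h_{\beta_l}$. A partition is a weakly decreasing composition. For an $r$-tuple $w=(w_0,\ldots,w_{r-1})$ of non-negative integers, let $v_i$ be the remainder of $w_i+i$ upon division by $r$. Set $\hat{s}_r(w)=(-1)^{\#\{i<j:\,v_i>v_j\}}$ if $v_0,\ldots,v_{r-1}$ are distinct, and $\hat{s}_r(w)=0$ otherwise. Composition sense: for a composition $\beta$ with $\ell(\beta)\le r$, $\hat{s}_r(\beta)=\sum_w\hat{s}_r(w)$ over all $r$-tuples $w$ of non-negative integers which yield $\beta$ when all zeros are deleted (preserving the order of the remaining entries); if $\ell(\beta)>r$, $\hat{s}_r(\beta)=0$.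 Partition sense: for a partition $\mu$, $\hat{s}_r(\mu)=\sum_\beta \hat{s}_r(\beta)$ over all distinct compositions $\beta$ (with $\hat{s}_r(\beta)$ in the composition sense) whose weakly decreasing rearrangement is $\mu$. *)

theory Defs
  imports Complex_Main "HOL-Library.Multiset"
begin

(* Formal power series over the rationals in the countably many variables x_0, x_1, ...
   A monomial is the multiset of the indices of its variables, with multiplicity,
   so multiplication of monomials is addition of multisets.  Symmetric functions are
   handled as elements of this ring. *)

typedef mpseries = "UNIV :: (nat multiset \<Rightarrow> rat) set"
  morphisms mcoeff MPSeries
  by simp

setup_lifting type_definition_mpseries

lemma mpseries_eqI: "(\<And>M. mcoeff f M = mcoeff g M) \<Longrightarrow> f = g"
  by (metis ext mcoeff_inject)

lemma finite_submultisets: "finite {A. A \<subseteq># (M :: 'a multiset)}"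
proof (induction M)
  case (add x M)
  have "{A. A \<subseteq># add_mset x M} \<subseteq> {A. A \<subseteq># M} \<union> add_mset x ` {A. A \<subseteq># M}"
  proof
    fix A assume "A \<in> {A. A \<subseteq># add_mset x M}"
    then have A: "A \<subseteq># add_mset x M" by simp
    show "A \<in> {A. A \<subseteq># M} \<union> add_mset x ` {A. A \<subseteq># M}"
    proof (cases "x \<in># A")
      case True
      then obtain B where "A = add_mset x B" by (meson mset_add)
      with A show ?thesis by auto
    next
      case False
      with A have "A \<subseteq># M"
        by (metis diff_single_trivial subset_eq_diff_conv add_mset_add_single)
      then show ?thesis by simp
    qed
  qed
  with add show ?case by (meson finite_UnI finite_imageI finite_subset)
qed simp

lemma finite_mset_splits: "finite {(A, B). A + B = (M :: 'a multiset)}"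
proof (rule finite_subset)
  show "{(A, B). A + B = M} \<subseteq> {A. A \<subseteq># M} \<times> {B. B \<subseteq># M}" by auto
qed (simp add: finite_submultisets)

instantiation mpseries :: comm_ring_1
begin

lift_definition zero_mpseries :: mpseries is "\<lambda>_. 0" .

lift_definition one_mpseries :: mpseries is "\<lambda>M. if M = {#} then 1 else 0" .

lift_definition plus_mpseries :: "mpseries \<Rightarrow> mpseries \<Rightarrow> mpseries"
  is "\<lambda>f g M. f M + g M" .

lift_definition minus_mpseries :: "mpseries \<Rightarrow> mpseries \<Rightarrow> mpseries"
  is "\<lambda>f g M. f M - g M" .

lift_definition uminus_mpseries :: "mpseries \<Rightarrow> mpseries"
  is "\<lambda>f M. - f M" .

lift_definition times_mpseries :: "mpseries \<Rightarrow> mpseries \<Rightarrow> mpseries"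
  is "\<lambda>f g M. \<Sum>(A, B) | A + B = M. f A * g B" .

instance
proof
  fix a b c :: mpseries
  show "a * b * c = a * (b * c)"
  proof (rule mpseries_eqI)
    fix M
    let ?f = "mcoeff a" and ?g = "mcoeff b" and ?h = "mcoeff c"
    have "mcoeff (a * b * c) M =
        (\<Sum>(P, C) | P + C = M. \<Sum>(A, B) | A + B = P. ?f A * ?g B * ?h C)"
      by (simp add: times_mpseries.rep_eq sum_distrib_right case_prod_unfold)
    also have "\<dots> = (\<Sum>((P, C), (A, B)) \<in> Sigma {(P, C). P + C = M} (\<lambda>(P, C). {(A, B). A + B = P}).
        ?f A * ?g B * ?h C)"
      by (subst sum.Sigma[symmetric])
         (use finite_mset_splits in \<open>auto simp: case_prod_unfold\<close>)
    also have "\<dots> = (\<Sum>((A, Q), (B, C)) \<in> Sigma {(A, Q). A + Q = M} (\<lambda>(A, Q). {(B, C). B + C = Q}).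
        ?f A * (?g B * ?h C))"
      by (rule sum.reindex_bij_witness
          [where i = "\<lambda>((A, Q), (B, C)). ((A + B, C), (A, B))"
             and j = "\<lambda>((P, C), (A, B)). ((A, B + C), (B, C))"])
         (auto simp: algebra_simps)
    also have "\<dots> = (\<Sum>(A, Q) | A + Q = M. \<Sum>(B, C) | B + C = Q. ?f A * (?g B * ?h C))"
      by (subst sum.Sigma[symmetric])
         (use finite_mset_splits in \<open>auto simp: case_prod_unfold\<close>)
    also have "\<dots> = mcoeff (a * (b * c)) M"
      by (simp add: times_mpseries.rep_eq sum_distrib_left case_prod_unfold)
    finally show "mcoeff (a * b * c) M = mcoeff (a * (b * c)) M" .
  qed
  show "a * b = b * a"
  proof (rule mpseries_eqI)
    fix M
    show "mcoeff (a * b) M = mcoeff (b * a) M"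
      unfolding times_mpseries.rep_eq
      by (rule sum.reindex_bij_witness[where i = prod.swap and j = prod.swap])
         (auto simp: ac_simps)
  qed
  show "1 * a = a"
  proof (rule mpseries_eqI)
    fix M
    have "mcoeff (1 * a) M =
        (\<Sum>p \<in> {(A, B). A + B = M}. if p = ({#}, M) then mcoeff a M else 0)"
      unfolding times_mpseries.rep_eq one_mpseries.rep_eq
      by (rule sum.cong) (auto split: if_splits)
    also have "\<dots> = mcoeff a M"
      by (subst sum.delta) (auto simp: finite_mset_splits)
    finally show "mcoeff (1 * a) M = mcoeff a M" .
  qed
  show "(a + b) * c = a * c + b * c"
    by (rule mpseries_eqI)
       (simp add: times_mpseries.rep_eq plus_mpseries.rep_eq sum.distrib case_prod_unfold
          algebra_simps)
  show "(0 :: mpseries) \<noteq> 1"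
    by transfer (metis zero_neq_one)
qed (transfer; simp add: algebra_simps; fail)+

end

lift_definition scale_mpseries :: "rat \<Rightarrow> mpseries \<Rightarrow> mpseries"  (infixr "*\<^sub>Q" 75)
  is "\<lambda>c f M. c * f M" .

lift_definition complete_hom :: "nat \<Rightarrow> mpseries"
  is "\<lambda>n M. if size M = n then 1 else 0" .

definition complete_hom_list :: "nat list \<Rightarrow> mpseries" where
  "complete_hom_list \<beta> = prod_list (map complete_hom \<beta>)"

(* The plethysm f[p_r], i.e. the series f(x_0^r, x_1^r, ...): the monomial N of f contributes to
   the monomial N^r, the r-fold repetition of N.  For r > 0 the sum has at most one term. *)
lift_definition plethysm_power_sum :: "mpseries \<Rightarrow> nat \<Rightarrow> mpseries"
  is "\<lambda>f r M. \<Sum>N | repeat_mset r N = M. f N" .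

definition compositions :: "nat \<Rightarrow> nat list set" where
  "compositions m = {\<beta>. 0 \<notin> set \<beta> \<and> sum_list \<beta> = m}"

definition partitions :: "nat \<Rightarrow> nat list set" where
  "partitions m = {\<mu> \<in> compositions m. sorted_wrt (\<ge>) \<mu>}"

lemma finite_compositions: "finite (compositions m)"
proof (rule finite_subset)
  show "compositions m \<subseteq> {\<beta>. set \<beta> \<subseteq> {..m} \<and> length \<beta> \<le> m}"
  proof
    fix \<beta> assume "\<beta> \<in> compositions m"
    then have "0 \<notin> set \<beta>" and m: "m = sum_list \<beta>" by (auto simp: compositions_def)
    then have "length \<beta> \<le> m"
    proof (induction \<beta> arbitrary: m)
      case (Cons a \<beta>)
      then have "length \<beta> \<le> sum_list \<beta>" "a > 0" by auto
      with Cons.prems show ?case by simp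
    qed simp
    then show "\<beta> \<in> {\<beta>. set \<beta> \<subseteq> {..m} \<and> length \<beta> \<le> m}"
      using m by (auto intro: member_le_sum_list)
  qed
qed (simp add: finite_lists_length_le)

(* The parameter r of the sign of an r-tuple is the length of the list. *)
definition tuple_residues :: "nat list \<Rightarrow> nat list" where
  "tuple_residues w = map (\<lambda>i. (w ! i + i) mod length w) [0..<length w]"

definition shat_tuple :: "nat list \<Rightarrow> int" where
  "shat_tuple w =
    (let v = tuple_residues w in
     if distinct v then (- 1) ^ card {(i, j). i < j \<and> j < length v \<and> v ! i > v ! j} else 0)"

definition shat_composition :: "nat \<Rightarrow> nat list \<Rightarrow> int" where
  "shat_composition r \<beta> =
    (if length \<beta> \<le> r
     then \<Sum>w | length w = r \<and> filter (\<lambda>x. x \<noteq> 0) w = \<beta>. shat_tuple w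
     else 0)"

lemma finite_zero_insertions: "finite {w :: nat list. length w = r \<and> filter (\<lambda>x. x \<noteq> 0) w = \<beta>}"
proof (rule finite_subset)
  show "{w. length w = r \<and> filter (\<lambda>x. x \<noteq> 0) w = \<beta>} \<subseteq> {w. set w \<subseteq> insert 0 (set \<beta>) \<and> length w = r}"
    by auto
qed (simp add: finite_lists_length_eq)

definition shat_partition :: "nat \<Rightarrow> nat list \<Rightarrow> int" where
  "shat_partition r \<mu> =
    (\<Sum>\<beta> | \<beta> \<in> compositions (sum_list \<mu>) \<and> rev (sort \<beta>) = \<mu>. shat_composition r \<beta>)"

end

theory Submission
  imports Defs "HOL-Combinatorics.Transposition"
begin

text \<open>
  Let \<open>R\<^sub>m\<close> be the sum of $\hat s_r(w) h_{w_0} \cdots h_{w_{r-1}}$ over all \<open>r\<close>-tuples \<open>w\<close> of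
  sum \<open>m\<close>.  The coefficient of $x_0^k$ in a product of complete functions is the sum over all ways
  of lowering the indices by \<open>k\<close> in total, so in \<open>R\<^sub>m\<close> this coefficient is governed by
  the sums of $\hat s_r(w + a)$ over the tuples \<open>a\<close> of sum \<open>k\<close>.  Such sums are complete symmetric
  functions of the shift operators.  The elementary ones are easy: raising a proper nonempty subset
  of \<open>r\<close> distinct residues produces a collision, and raising all of them gives the factor
  $(-1)^{r-1}$.  Hence the sum is $\hat s_r(w)$ if \<open>r\<close> divides \<open>k\<close> and \<open>0\<close> otherwise, which is
  the recursion satisfied by $h_n[p_r]$ as well.

  The products \<open>h\<^sub>\<mu>\<close> are linearly independent because the adjoint of multiplication by \<open>e\<^sub>l\<close>
  lowers \<open>l\<close> of the indices by one: for the largest length \<open>l\<close> in a relation it leaves a relation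
  of smaller degree.
\<close>

section \<open>Weak compositions indexed by a finite set\<close>

definition weak_comps :: "'i set \<Rightarrow> nat \<Rightarrow> ('i \<Rightarrow> nat) set" where
  "weak_comps I k = {a. (\<forall>i. i \<notin> I \<longrightarrow> a i = 0) \<and> sum a I = k}"

lemma finite_weak_comps [simp]:
  assumes "finite I"
  shows "finite (weak_comps I k)"
proof (rule finite_subset)
  show "weak_comps I k \<subseteq> {a. \<forall>i. (i \<in> I \<longrightarrow> a i \<in> {..k}) \<and> (i \<notin> I \<longrightarrow> a i = 0)}"
    using assms by (auto simp: weak_comps_def intro: member_le_sum)
  show "finite {a. \<forall>i. (i \<in> I \<longrightarrow> a i \<in> {..k}) \<and> (i \<notin> I \<longrightarrow> a i = (0::nat))}"
    by (rule finite_set_of_finite_funs) (use assms in auto)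
qed

lemma weak_comps_0 [simp]: "finite I \<Longrightarrow> weak_comps I 0 = {\<lambda>_. 0}"
  by (auto simp: weak_comps_def)

lemma weak_comps_empty: "weak_comps {} k = (if k = 0 then {\<lambda>_. 0} else {})"
  by (auto simp: weak_comps_def)

lemma sum_weak_comps_insert:
  assumes "finite I" "x \<notin> I"
  shows "(\<Sum>a\<in>weak_comps (insert x I) k. f a) =
    (\<Sum>j\<le>k. \<Sum>a\<in>weak_comps I (k - j). f (a(x := j)))"
proof -
  have upd: "(\<Sum>i\<in>I. if i = x then j else a i) = sum a I" for a :: "'a \<Rightarrow> nat" and j
    by (rule sum.cong) (use assms in auto)
  have "(\<Sum>j\<le>k. \<Sum>a\<in>weak_comps I (k - j). f (a(x := j))) =
      (\<Sum>(j, a)\<in>Sigma {..k} (\<lambda>j. weak_comps I (k - j)). f (a(x := j)))"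
    by (rule sum.Sigma) (use assms in auto)
  also have "\<dots> = (\<Sum>a\<in>weak_comps (insert x I) k. f a)"
    by (rule sum.reindex_bij_witness[where i = "\<lambda>a. (a x, a(x := 0))"
          and j = "\<lambda>(j, a). a(x := j)"])
       (use assms in \<open>auto simp: weak_comps_def upd fun_eq_iff\<close>)
  finally show ?thesis by simp
qed

text \<open>Inserting or removing one fixed element \<open>x\<close> of \<open>T\<close> pairs off
  the subsets with opposite signs.\<close>

lemma sum_Pow_minus_one_power:
  assumes "finite T" "T \<noteq> {}"
  shows "(\<Sum>S\<in>Pow T. (- 1) ^ card S) = (0 :: 'a :: comm_ring_1)"
proof -
  obtain x U where T: "T = insert x U" "x \<notin> U" using assms by (meson mk_disjoint_insert ex_in_conv)
  then have fU: "finite U" using assms by simp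
  have "(\<Sum>S\<in>Pow T. (- 1) ^ card S :: 'a) =
      (\<Sum>S\<in>Pow U. (- 1) ^ card S) + (\<Sum>S\<in>insert x ` Pow U. (- 1) ^ card S)"
    unfolding T(1) Pow_insert by (rule sum.union_disjoint) (use fU T in auto)
  also have "(\<Sum>S\<in>insert x ` Pow U. (- 1) ^ card S :: 'a) = (\<Sum>S\<in>Pow U. (- 1) ^ card (insert x S))"
    by (subst sum.reindex) (use T in \<open>auto simp: inj_on_def\<close>)
  also have "\<dots> = (\<Sum>S\<in>Pow U. - ((- 1) ^ card S))"
  proof (rule sum.cong)
    fix S assume "S \<in> Pow U"
    then have "finite S" "x \<notin> S" using fU T finite_subset by auto
    then show "(- 1) ^ card (insert x S) = (- ((- 1) ^ card S) :: 'a)" by simp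
  qed simp
  finally show ?thesis by (simp add: sum_negf)
qed

text \<open>The relation $\sum_j (-1)^j e_j h_{m-j} = 0$ between elementary and complete symmetric
  functions, read in the variables shifting the arguments of an arbitrary function \<open>f\<close>.\<close>

lemma alternating_sum_weak_comps:
  fixes f :: "('i \<Rightarrow> nat) \<Rightarrow> 'a :: comm_ring_1"
  assumes fin: "finite I" and "m > 0"
  shows "(\<Sum>j\<le>m. (- 1) ^ j *
    (\<Sum>S | S \<subseteq> I \<and> card S = j. \<Sum>a\<in>weak_comps I (m - j). f (\<lambda>i. a i + of_bool (i \<in> S)))) = 0"
proof -
  let ?sub = "\<lambda>j. {S. S \<subseteq> I \<and> card S = j}"
  have fsub: "finite (?sub j)" for j
    by (rule finite_subset[of _ "Pow I"]) (use fin in auto)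
  have sum_ind: "(\<Sum>i\<in>I. of_bool (i \<in> S)) = card S" if "S \<subseteq> I" for S
    using that fin by (simp add: of_bool_def sum.If_cases Int_absorb1)
  have "(\<Sum>j\<le>m. (- 1) ^ j *
      (\<Sum>S\<in>?sub j. \<Sum>a\<in>weak_comps I (m - j). f (\<lambda>i. a i + of_bool (i \<in> S)))) =
    (\<Sum>j\<le>m. \<Sum>(S, a)\<in>?sub j \<times> weak_comps I (m - j).
      (- 1) ^ j * f (\<lambda>i. a i + of_bool (i \<in> S)))"
    by (simp add: sum.cartesian_product sum_distrib_left case_prod_unfold)
  also have "\<dots> = (\<Sum>(j, S, a)\<in>Sigma {..m} (\<lambda>j. ?sub j \<times> weak_comps I (m - j)).
      (- 1) ^ j * f (\<lambda>i. a i + of_bool (i \<in> S)))"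
    by (subst sum.Sigma) (use fin fsub in \<open>auto simp: case_prod_unfold\<close>)
  \<comment> \<open>Collect by the total shift \<open>b\<close>, the sum of \<open>a\<close> and the
    indicator of \<open>S\<close>. Given \<open>b\<close>, the sets \<open>S\<close> that occur are
    exactly the subsets of its support, and \<open>a\<close> is recovered by subtraction.\<close>
  also have "\<dots> = (\<Sum>(b, S)\<in>Sigma (weak_comps I m) (\<lambda>b. Pow {i \<in> I. b i > 0}). (- 1) ^ card S * f b)"
  proof (rule sum.reindex_bij_witness[where i = "\<lambda>(b, S). (card S, S, \<lambda>i. b i - of_bool (i \<in> S))"
        and j = "\<lambda>(j, S, a). (\<lambda>i. a i + of_bool (i \<in> S), S)"], goal_cases)
    case (2 x)
    then show ?case by (auto simp: weak_comps_def sum.distrib sum_ind subset_iff)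
  next
    case (4 y)
    obtain b S where y: "y = (b, S)" by force
    have S: "S \<subseteq> I" "\<And>i. i \<in> S \<Longrightarrow> b i > 0" and b: "b \<in> weak_comps I m" using 4 y by auto
    have "(\<Sum>i\<in>I. b i - of_bool (i \<in> S)) + (\<Sum>i\<in>I. of_bool (i \<in> S)) = sum b I"
      unfolding sum.distrib[symmetric] by (rule sum.cong) (use S in \<open>auto simp: of_bool_def Suc_leI\<close>)
    then have "(\<Sum>i\<in>I. b i - of_bool (i \<in> S)) + card S = m"
      using b S by (simp add: sum_ind weak_comps_def)
    then show ?case using S b y by (auto simp: weak_comps_def)
  next
    case (3 y)
    then show ?case by (auto simp: fun_eq_iff of_bool_def Suc_leI subset_iff)
  qed (auto simp: fun_eq_iff)
  also have "\<dots> = (\<Sum>b\<in>weak_comps I m. \<Sum>S\<in>Pow {i \<in> I. b i > 0}. (- 1) ^ card S * f b)"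
    by (subst sum.Sigma[symmetric]) (use fin in auto)
  \<comment> \<open>As \<open>m > 0\<close>, the support of \<open>b\<close> is nonempty, so the
    signs of its subsets cancel.\<close>
  also have "\<dots> = (\<Sum>b\<in>weak_comps I m. 0)"
  proof (rule sum.cong)
    fix b assume "b \<in> weak_comps I m"
    then have "sum b I > 0" using \<open>m > 0\<close> by (simp add: weak_comps_def)
    then have "{i \<in> I. b i > 0} \<noteq> {}" using sum.not_neutral_contains_not_neutral[of b I] by auto
    then show "(\<Sum>S\<in>Pow {i \<in> I. b i > 0}. (- 1) ^ card S * f b) = 0"
      using sum_Pow_minus_one_power[of "{i \<in> I. b i > 0}", where 'a = 'a] fin
      by (simp add: sum_distrib_right[symmetric])
  qed simp
  finally show ?thesis by simp
qed

section \<open>The sign of a tuple of residues\<close>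

text \<open>The sign of a Vandermonde product in the residues: it is 0 on a collision because
  \<open>sgn 0 = 0\<close>, and otherwise it counts inversions modulo 2. The summand
  \<open>i\<close> in the residue of \<open>w i + i\<close> is left to the argument
  \<open>u\<close>, so that shifts act by plain addition.\<close>

definition residue_sign :: "nat \<Rightarrow> (nat \<Rightarrow> nat) \<Rightarrow> int" where
  "residue_sign r u = (\<Prod>(i, j) | i < j \<and> j < r. sgn (int (u j mod r) - int (u i mod r)))"

lemma finite_pairs [simp]: "finite {(i, j). i < j \<and> j < (r :: nat)}"
  by (rule finite_subset[of _ "{..<r} \<times> {..<r}"]) auto

lemma residue_sign_cong:
  assumes "\<And>i. i < r \<Longrightarrow> u i mod r = v i mod r"
  shows "residue_sign r u = residue_sign r v"
  unfolding residue_sign_def by (rule prod.cong) (use assms in auto)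

lemma residue_sign_eq_0:
  assumes "i < r" "j < r" "i \<noteq> j" "u i mod r = u j mod r"
  shows "residue_sign r u = 0"
proof -
  have "(min i j, max i j) \<in> {(i, j). i < j \<and> j < r}"
    "u (max i j) mod r = u (min i j) mod r"
    using assms by (auto simp: min_def max_def)
  then show ?thesis unfolding residue_sign_def
    by (intro prod_zero bexI[of _ "(min i j, max i j)"]) auto
qed

text \<open>An adjacent transposition permutes the pairs \<open>i < j\<close> other than
  \<open>(p, Suc p)\<close> without reversing any, and negates the factor of that one pair.\<close>

lemma residue_sign_adjacent:
  assumes "Suc p < r"
  shows "residue_sign r (u \<circ> transpose p (Suc p)) = - residue_sign r u"
proof -
  let ?t = "transpose p (Suc p)"
  let ?P = "{(i, j). i < j \<and> j < r}"
  let ?F = "\<lambda>u (i, j). sgn (int (u j mod r) - int (u i mod r))"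
  have mem: "(p, Suc p) \<in> ?P" using assms by simp
  have "prod (?F (u \<circ> ?t)) (?P - {(p, Suc p)}) = prod (?F u) (?P - {(p, Suc p)})"
    by (rule prod.reindex_bij_witness[where i = "\<lambda>(i, j). (?t i, ?t j)" and j = "\<lambda>(i, j). (?t i, ?t j)"])
       (use assms in \<open>auto simp: transpose_def split: if_splits\<close>)
  moreover have "?F (u \<circ> ?t) (p, Suc p) = - ?F u (p, Suc p)"
    by (simp add: sgn_if)
  ultimately show ?thesis
    unfolding residue_sign_def by (simp add: prod.remove[OF finite_pairs mem])
qed

text \<open>Conjugating by the transposition of \<open>q\<close> and \<open>Suc q\<close> reduces
  \<open>Suc q\<close> to \<open>q\<close>; the three factors contribute three changes of
  sign.\<close>

lemma residue_sign_transpose: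
  assumes "p < q" "q < r"
  shows "residue_sign r (u \<circ> transpose p q) = - residue_sign r u"
  using assms
proof (induction q arbitrary: u)
  case (Suc q)
  show ?case
  proof (cases "p = q")
    case True
    show ?thesis unfolding True by (rule residue_sign_adjacent) (use Suc.prems in auto)
  next
    case False
    let ?t = "transpose q (Suc q)"
    have conj: "u \<circ> transpose p (Suc q) = u \<circ> ?t \<circ> transpose p q \<circ> ?t"
      using False Suc.prems by (auto simp: fun_eq_iff transpose_def)
    have "residue_sign r (u \<circ> ?t \<circ> transpose p q \<circ> ?t) = - residue_sign r (u \<circ> ?t \<circ> transpose p q)"
      by (rule residue_sign_adjacent) (use Suc.prems in auto)
    also have "residue_sign r (u \<circ> ?t \<circ> transpose p q) = - residue_sign r (u \<circ> ?t)"
      by (rule Suc.IH) (use Suc.prems False in auto)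
    also have "residue_sign r (u \<circ> ?t) = - residue_sign r u"
      by (rule residue_sign_adjacent) (use Suc.prems in auto)
    finally show ?thesis unfolding conj by simp
  qed
qed simp

lemma residues_surj:
  assumes "inj_on (\<lambda>i. u i mod r) {..<r}" "c < (r :: nat)"
  obtains i where "i < r" "u i mod r = c"
proof -
  have "(\<lambda>i. u i mod r) ` {..<r} = {..<r}"
    by (rule card_subset_eq) (use assms in \<open>auto simp: card_image\<close>)
  then have "c \<in> (\<lambda>i. u i mod r) ` {..<r}" using assms(2) by simp
  then show ?thesis using that by auto
qed

text \<open>If the residues are distinct, exactly one position \<open>p\<close> has residue
  \<open>r - 1\<close>. It wraps from largest to smallest, while the order among the others is kept,
  so precisely the \<open>r - 1\<close> pairs containing \<open>p\<close> change sign. A collision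
  persists under the shift and makes both sides 0.\<close>

lemma residue_sign_Suc:
  assumes "r > 0"
  shows "residue_sign r (\<lambda>i. u i + 1) = (- 1) ^ (r - 1) * residue_sign r u"
proof (cases "inj_on (\<lambda>i. u i mod r) {..<r}")
  case False
  then obtain i j where ij: "i < r" "j < r" "i \<noteq> j" "u i mod r = u j mod r"
    by (auto simp: inj_on_def)
  then have "(u i + 1) mod r = (u j + 1) mod r" by (metis mod_add_left_eq)
  then show ?thesis
    using residue_sign_eq_0[of i r j u] residue_sign_eq_0[of i r j "\<lambda>i. u i + 1"] ij by simp
next
  case True
  obtain p where p: "p < r" "u p mod r = r - 1"
    using residues_surj[OF True, of "r - 1"] assms by auto
  have neq: "u i mod r \<noteq> r - 1" if "i < r" "i \<noteq> p" for i
    using True that p by (metis inj_onD lessThan_iff)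
  have up: "(u p + 1) mod r = 0" using p assms by (simp add: mod_Suc)
  have ui: "(u i + 1) mod r = u i mod r + 1" "u i mod r < r - 1" if "i < r" "i \<noteq> p" for i
    using neq[OF that] mod_less_divisor[OF assms, of "u i"] by (auto simp: mod_Suc)
  let ?P = "{(i, j). i < j \<and> j < r}"
  let ?Q = "{(i, j). i < j \<and> j < r \<and> (i = p \<or> j = p)}"
  \<comment> \<open>A pair containing \<open>p\<close> is determined by its other member.\<close>
  have "card ?Q = card ({..<r} - {p})"
    by (rule bij_betw_same_card[symmetric],
        rule bij_betw_byWitness[where f = "\<lambda>k. (min k p, max k p)" and f' = "\<lambda>(i, j). if i = p then j else i"])
       (use p in \<open>auto simp: min_def max_def\<close>)
  then have cQ: "card ?Q = r - 1" using p by simp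
  have "residue_sign r (\<lambda>i. u i + 1) =
    (\<Prod>(i, j)\<in>?P. (if i = p \<or> j = p then - 1 else 1) * sgn (int (u j mod r) - int (u i mod r)))"
    unfolding residue_sign_def
  proof (rule prod.cong, simp, clarify)
    fix i j assume ij: "i < j" "j < r"
    consider "i = p" | "j = p" | "i \<noteq> p" "j \<noteq> p" by blast
    then show "sgn (int ((u j + 1) mod r) - int ((u i + 1) mod r)) =
      (if i = p \<or> j = p then - 1 else 1) * sgn (int (u j mod r) - int (u i mod r))"
    proof cases
      case 1
      have "(u j + 1) mod r = u j mod r + 1" "u j mod r < r - 1" using ui[of j] ij 1 by auto
      then show ?thesis using 1 up p assms by (auto simp: sgn_if of_nat_diff)
    next
      case 2
      have "(u i + 1) mod r = u i mod r + 1" "u i mod r < r - 1" using ui[of i] ij 2 by auto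
      then show ?thesis using 2 up p assms by (auto simp: sgn_if of_nat_diff)
    next
      case 3
      have "(u i + 1) mod r = u i mod r + 1" "(u j + 1) mod r = u j mod r + 1"
        using ui[of i] ui[of j] ij 3 by auto
      then show ?thesis using 3 by simp
    qed
  qed
  also have "\<dots> = (\<Prod>(i, j)\<in>?P. if i = p \<or> j = p then - 1 else 1) * residue_sign r u"
    by (simp add: residue_sign_def prod.distrib case_prod_unfold)
  also have "(\<Prod>(i, j)\<in>?P. if i = p \<or> j = p then - 1 else (1::int)) = (\<Prod>x\<in>?Q. - 1)"
    by (rule prod.mono_neutral_cong_right) (auto split: if_splits)
  finally show ?thesis using cQ by simp
qed

text \<open>With distinct residues every term vanishes, since raising a proper nonempty subset
  creates a collision. With equal residues at \<open>p\<close> and \<open>q\<close>, exchanging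
  these positions permutes the subsets and negates the sum.\<close>

lemma sum_residue_sign_subsets:
  assumes "0 < j" "j < r"
  shows "(\<Sum>S | S \<subseteq> {..<r} \<and> card S = j. residue_sign r (\<lambda>i. u i + of_bool (i \<in> S))) = 0"
proof (cases "inj_on (\<lambda>i. u i mod r) {..<r}")
  case True
  show ?thesis
  proof (rule sum.neutral, safe)
    fix S assume S: "S \<subseteq> {..<r}" "j = card S"
    then have fS: "finite S" using finite_subset by blast
    \<comment> \<open>Otherwise the residues on \<open>S\<close> would be closed under adding 1
      modulo \<open>r\<close>, hence would be all residues, forcing \<open>S\<close> to be
      everything against \<open>card S = j < r\<close>.\<close>
    have "\<exists>i\<in>S. \<exists>k<r. k \<notin> S \<and> u k mod r = (u i + 1) mod r"
    proof (rule ccontr)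
      assume contra: "\<not> ?thesis"
      have closed: "\<exists>k\<in>S. u k mod r = (u i + 1) mod r" if "i \<in> S" for i
        using residues_surj[OF True, of "(u i + 1) mod r"] contra that assms
        by (metis less_trans mod_less_divisor)
      obtain i where i: "i \<in> S" using S assms by (metis card.empty ex_in_conv less_irrefl)
      have reach: "\<exists>k\<in>S. u k mod r = (u i + d) mod r" for d
      proof (induction d)
        case (Suc d)
        then show ?case using closed by (metis add_Suc_right Suc_eq_plus1 mod_Suc_eq)
      qed (use i in auto)
      have "{..<r} \<subseteq> S"
      proof
        fix l assume l: "l \<in> {..<r}"
        have "u i mod r \<le> r" using assms by (simp add: less_imp_le_nat)
        then have "(u i + (u l + (r - u i mod r))) mod r = u l mod r"
          using mod_add_left_eq[of "u i" r "u l + (r - u i mod r)"] by simp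
        then obtain k where "k \<in> S" "u k mod r = u l mod r" using reach by metis
        then show "l \<in> S" using True S l by (metis inj_onD subsetD)
      qed
      then show False using card_mono[OF fS] S assms by fastforce
    qed
    then obtain i k where "i \<in> S" "k < r" "k \<notin> S" "u k mod r = (u i + 1) mod r" by blast
    then show "residue_sign r (\<lambda>i. u i + of_bool (i \<in> S)) = 0"
      using S by (intro residue_sign_eq_0[of i _ k]) auto
  qed
next
  case False
  then obtain p q where pq: "p < q" "q < r" "u p mod r = u q mod r"
    unfolding inj_on_def by (metis lessThan_iff linorder_neqE_nat)
  let ?t = "transpose p q"
  let ?A = "{S. S \<subseteq> {..<r} \<and> card S = j}"
  have t_less: "?t i < r \<longleftrightarrow> i < r" for i using pq by (auto simp: transpose_def)
  have "(\<Sum>S\<in>?A. residue_sign r (\<lambda>i. u i + of_bool (i \<in> S))) =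
      (\<Sum>S\<in>?A. residue_sign r (\<lambda>i. u i + of_bool (i \<in> ?t ` S)))"
    by (rule sum.reindex_bij_witness[where i = "\<lambda>S. ?t ` S" and j = "\<lambda>S. ?t ` S"])
       (auto simp: image_image t_less card_image)
  \<comment> \<open>Since \<open>u\<close> takes the same residue at \<open>p\<close> and
    \<open>q\<close>, transposing \<open>S\<close> has the same effect on residues as transposing
    all positions.\<close>
  also have "\<dots> = (\<Sum>S\<in>?A. residue_sign r ((\<lambda>i. u i + of_bool (i \<in> S)) \<circ> ?t))"
  proof (rule sum.cong[OF refl], rule residue_sign_cong)
    fix S i
    have "u (?t i) mod r = u i mod r" using pq by (auto simp: transpose_def)
    then have "(u i + of_bool (?t i \<in> S)) mod r = (u (?t i) + of_bool (?t i \<in> S)) mod r"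
      by (rule mod_add_cong[OF sym refl])
    moreover have "i \<in> ?t ` S \<longleftrightarrow> ?t i \<in> S" by (metis image_iff transpose_involutory)
    ultimately show "(u i + of_bool (i \<in> ?t ` S)) mod r =
        ((\<lambda>i. u i + of_bool (i \<in> S)) \<circ> ?t) i mod r"
      by (simp only: comp_def)
  qed
  also have "\<dots> = - (\<Sum>S\<in>?A. residue_sign r (\<lambda>i. u i + of_bool (i \<in> S)))"
    using pq by (simp add: residue_sign_transpose sum_negf)
  finally show ?thesis by simp
qed

text \<open>Write \<open>T k\<close> for the left side. In the alternating relation for
  \<open>T\<close> only the terms \<open>j = 0\<close> and \<open>j = r\<close> survive, which gives
  \<open>T k = T (k - r)\<close> for \<open>k\<close> at least \<open>r\<close> and
  \<open>T k = 0\<close> for \<open>0 < k < r\<close>.\<close>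

lemma sum_residue_sign_weak_comps:
  assumes "r > 0"
  shows "(\<Sum>a\<in>weak_comps {..<r} k. residue_sign r (\<lambda>i. s i + a i)) =
    (if r dvd k then residue_sign r s else 0)"
proof (induction k rule: less_induct)
  case (less k)
  let ?T = "\<lambda>k. \<Sum>a\<in>weak_comps {..<r} k. residue_sign r (\<lambda>i. s i + a i)"
  show ?case
  proof (cases "k = 0")
    case False
    define X where "X j = (- 1) ^ j * (\<Sum>S | S \<subseteq> {..<r} \<and> card S = j.
      \<Sum>a\<in>weak_comps {..<r} (k - j). residue_sign r (\<lambda>i. s i + (a i + of_bool (i \<in> S))))" for j
    have swap: "X j = (- 1) ^ j * (\<Sum>a\<in>weak_comps {..<r} (k - j).
        \<Sum>S | S \<subseteq> {..<r} \<and> card S = j. residue_sign r (\<lambda>i. (s i + a i) + of_bool (i \<in> S)))" for j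
      unfolding X_def by (subst sum.swap) (simp add: add.assoc)
    have X0: "X 0 = ?T k"
    proof -
      have "{S. S \<subseteq> {..<r} \<and> card S = 0} = {{}}" using finite_subset by fastforce
      then show ?thesis by (simp add: X_def)
    qed
    have Xr: "X r = - ?T (k - r)"
    proof -
      have "{S. S \<subseteq> {..<r} \<and> card S = r} = {{..<r}}"
        using card_subset_eq[of "{..<r}"] by auto
      then have "X r = (- 1) ^ r * (\<Sum>a\<in>weak_comps {..<r} (k - r).
          residue_sign r (\<lambda>i. (s i + a i) + of_bool (i < r)))"
        by (simp add: swap)
      also have "\<dots> = (- 1) ^ r * (\<Sum>a\<in>weak_comps {..<r} (k - r).
          residue_sign r (\<lambda>i. (s i + a i) + 1))"
        by (intro arg_cong2[where f = "(*)"] sum.cong residue_sign_cong refl) auto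
      also have "\<dots> = (- 1) ^ r * (- 1) ^ (r - 1) * ?T (k - r)"
        using assms by (simp only: residue_sign_Suc sum_distrib_left mult.assoc)
      \<comment> \<open>The sign of the full shift and the sign in the alternating relation have
        opposite parity, so the result is -1 for every \<open>r\<close>.\<close>
      also have "(- 1) ^ r * (- 1) ^ (r - 1) = (- 1 :: int)"
        using assms by (cases r) (auto simp: power_mult_distrib[symmetric])
      finally show ?thesis by simp
    qed
    have Xj: "X j = 0" if "j \<noteq> 0" "j \<noteq> r" for j
    proof (cases "j < r")
      case True
      then show ?thesis using that by (simp add: swap sum_residue_sign_subsets)
    next
      case False
      have "card S \<noteq> j" if S: "S \<subseteq> {..<r}" for S
        using card_mono[OF _ S] False \<open>j \<noteq> r\<close> by simp
      then have "{S. S \<subseteq> {..<r} \<and> card S = j} = {}" by blast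
      then show ?thesis unfolding X_def by (simp only: sum.empty mult_zero_right)
    qed
    have "0 = (\<Sum>j\<le>k. X j)"
      unfolding X_def
      by (rule alternating_sum_weak_comps[symmetric, where f = "\<lambda>b. residue_sign r (\<lambda>i. s i + b i)"])
         (use False in auto)
    also have "\<dots> = (\<Sum>j\<in>(if r \<le> k then {0, r} else {0}). X j)"
      by (rule sum.mono_neutral_right) (auto intro: Xj split: if_splits)
    also have "\<dots> = ?T k - (if r \<le> k then ?T (k - r) else 0)"
      using assms by (auto simp: X0 Xr)
    finally have rec: "?T k = (if r \<le> k then ?T (k - r) else 0)" by simp
    show ?thesis
    proof (cases "r \<le> k")
      case True
      then show ?thesis using rec less[of "k - r"] assms by (simp add: dvd_minus_self)
    next
      case r: False
      then have "\<not> r dvd k" using False by (auto dest: dvd_imp_le)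
      then show ?thesis using rec r by simp
    qed
  qed simp
qed

text \<open>Inverted pairs contribute the factor -1 and all others 1; a repeated residue makes both
  sides 0.\<close>

lemma shat_tuple_eq_residue_sign:
  "shat_tuple (map w [0..<r]) = residue_sign r (\<lambda>i. w i + i)"
proof -
  define v where "v = tuple_residues (map w [0..<r])"
  have v: "length v = r" "\<And>i. i < r \<Longrightarrow> v ! i = (w i + i) mod r"
    by (auto simp: v_def tuple_residues_def)
  show ?thesis
  proof (cases "distinct v")
    case False
    then obtain i j where "i < r" "j < r" "i \<noteq> j" "v ! i = v ! j"
      by (auto simp: distinct_conv_nth v)
    then have "residue_sign r (\<lambda>i. w i + i) = 0"
      by (intro residue_sign_eq_0[of i _ j]) (auto simp: v)
    then show ?thesis using False by (simp add: shat_tuple_def v_def[symmetric])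
  next
    case True
    have "residue_sign r (\<lambda>i. w i + i) =
        (\<Prod>(i, j) | i < j \<and> j < r. if v ! i > v ! j then - 1 else 1)"
      unfolding residue_sign_def
    proof (rule prod.cong, simp, clarify)
      fix i j assume ij: "i < j" "j < r"
      then have "v ! i \<noteq> v ! j" using True by (simp add: v distinct_conv_nth)
      then show "sgn (int ((w j + j) mod r) - int ((w i + i) mod r)) = (if v ! i > v ! j then - 1 else 1)"
        using ij by (auto simp: v sgn_if)
    qed
    also have "\<dots> = (\<Prod>x | x \<in> {(i, j). i < j \<and> j < r \<and> v ! i > v ! j}. - 1)"
      by (rule prod.mono_neutral_cong_right) (auto split: if_splits)
    finally show ?thesis using True by (simp add: shat_tuple_def v_def[symmetric] v(1) Let_def)
  qed
qed

section \<open>Extracting powers of the first variable\<close>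

text \<open>The coefficient of $x_0^k$, with the remaining variables $x_1, x_2, \ldots$ renamed to
  $x_0, x_1, \ldots$; on symmetric functions this is the operator $h_k^\perp$.\<close>

lift_definition h_perp :: "nat \<Rightarrow> mpseries \<Rightarrow> mpseries"
  is "\<lambda>k f M. f (replicate_mset k 0 + image_mset Suc M)" .

lemmas mcoeff_simps = zero_mpseries.rep_eq one_mpseries.rep_eq plus_mpseries.rep_eq
  minus_mpseries.rep_eq uminus_mpseries.rep_eq scale_mpseries.rep_eq h_perp.rep_eq

lemma mcoeff_sum: "mcoeff (\<Sum>x\<in>A. f x) M = (\<Sum>x\<in>A. mcoeff (f x) M)"
  by (induction A rule: infinite_finite_induct) (simp_all add: mcoeff_simps)

lemma scale_1 [simp]: "1 *\<^sub>Q f = f"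
  and scale_0 [simp]: "0 *\<^sub>Q f = 0"
  and scale_zero [simp]: "c *\<^sub>Q 0 = 0"
  and scale_diff: "(c - d) *\<^sub>Q f = c *\<^sub>Q f - d *\<^sub>Q f"
  by (rule mpseries_eqI; simp add: mcoeff_simps algebra_simps)+

lemma scale_sum_right: "c *\<^sub>Q (\<Sum>x\<in>A. f x) = (\<Sum>x\<in>A. c *\<^sub>Q f x)"
  and scale_sum_left: "(\<Sum>x\<in>A. a x) *\<^sub>Q g = (\<Sum>x\<in>A. a x *\<^sub>Q g)"
  by (rule mpseries_eqI; simp add: mcoeff_simps mcoeff_sum sum_distrib_left sum_distrib_right)+

lemma h_perp_scale: "h_perp k (c *\<^sub>Q f) = c *\<^sub>Q h_perp k f"
  and h_perp_sum: "h_perp k (\<Sum>x\<in>A. F x) = (\<Sum>x\<in>A. h_perp k (F x))"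
  by (rule mpseries_eqI; simp add: mcoeff_simps mcoeff_sum)+

lemma h_perp_1: "h_perp k 1 = (if k = 0 then 1 else 0)"
  by (rule mpseries_eqI) (auto simp: mcoeff_simps)

text \<open>Inverse to the renaming in \<open>h_perp\<close>: together with the exponent of the
  variable with index 0 it determines the monomial.\<close>

definition shift_down :: "nat multiset \<Rightarrow> nat multiset" where
  "shift_down M = image_mset (\<lambda>n. n - 1) (filter_mset (\<lambda>n. n \<noteq> 0) M)"

lemma shift_down_simps [simp]:
  "shift_down {#} = {#}"
  "shift_down (A + B) = shift_down A + shift_down B"
  "shift_down (replicate_mset k 0) = {#}"
  "shift_down (image_mset Suc M) = M"
  by (auto simp: shift_down_def filter_mset_image_mset image_mset.compositionality comp_def
      filter_mset_eq_conv[of _ "replicate_mset k 0"])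

lemma shift_down_split: "M = replicate_mset (count M 0) 0 + image_mset Suc (shift_down M)"
proof (induction M)
  case (add x M)
  then show ?case by (cases x) (auto simp: shift_down_def)
qed simp

lemma count_image_Suc_0 [simp]: "count (image_mset Suc M) 0 = 0"
  by (auto simp: count_eq_zero_iff)

lemma replicate_mset_add: "replicate_mset (a + b) x = replicate_mset a x + replicate_mset b x"
  by (induction a) auto

text \<open>The exponent \<open>k\<close> of the first variable is distributed over the two factors.
  Splitting \<open>C\<close> and \<open>D\<close> into their powers of that variable and the rest
  matches the terms bijectively.\<close>

lemma h_perp_mult: "h_perp k (f * g) = (\<Sum>i\<le>k. h_perp i f * h_perp (k - i) g)"
proof (rule mpseries_eqI)
  fix M
  let ?E = "\<lambda>k A. replicate_mset k 0 + image_mset Suc A"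
  have cancel: "A + B = M \<and> k = count C 0 + count D 0"
    if "C + D = ?E k M" "A = shift_down C" "B = shift_down D" for A B C D
  proof -
    have "shift_down (C + D) = M" "count (C + D) 0 = k" unfolding that(1) by simp_all
    then show ?thesis unfolding that(2,3) by simp
  qed
  have "mcoeff (\<Sum>i\<le>k. h_perp i f * h_perp (k - i) g) M =
    (\<Sum>i\<le>k. \<Sum>(A, B) | A + B = M. mcoeff f (?E i A) * mcoeff g (?E (k - i) B))"
    by (simp add: mcoeff_sum times_mpseries.rep_eq h_perp.rep_eq)
  also have "\<dots> = (\<Sum>(i, A, B)\<in>Sigma {..k} (\<lambda>_. {(A, B). A + B = M}).
      mcoeff f (?E i A) * mcoeff g (?E (k - i) B))"
    by (subst sum.Sigma) (use finite_mset_splits in \<open>auto simp: case_prod_unfold\<close>)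
  also have "\<dots> = (\<Sum>(C, D) | C + D = ?E k M. mcoeff f C * mcoeff g D)"
  proof (rule sum.reindex_bij_witness[where j = "\<lambda>(i, A, B). (?E i A, ?E (k - i) B)"
        and i = "\<lambda>(C, D). (count C 0, shift_down C, shift_down D)"], goal_cases)
    case (2 x)
    obtain i A B where x: "x = (i, A, B)" by (cases x)
    have "replicate_mset i (0::nat) + replicate_mset (k - i) 0 = replicate_mset k 0"
      using 2 x by (simp add: replicate_mset_add[symmetric])
    then show ?case using 2 x by (auto simp: ac_simps)
  next
    case (3 y)
    obtain C D where y: "y = (C, D)" by (cases y)
    then have CD: "C + D = ?E k M" using 3 by simp
    have "k = count C 0 + count D 0" using cancel[OF CD refl refl] by simp
    then show ?case using shift_down_split[of C] shift_down_split[of D] y by simp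
  next
    case (4 y)
    obtain C D where y: "y = (C, D)" by (cases y)
    then show ?case using 4 cancel[of C D, OF _ refl refl] by simp
  qed auto
  also have "\<dots> = mcoeff (h_perp k (f * g)) M"
    by (simp add: h_perp.rep_eq times_mpseries.rep_eq)
  finally show "mcoeff (h_perp k (f * g)) M = mcoeff (\<Sum>i\<le>k. h_perp i f * h_perp (k - i) g) M"
    by simp
qed

text \<open>Indexing by integers, with value \<open>0\<close> at negative indices, spares all side conditions
  when indices are lowered.\<close>

definition hom_int :: "int \<Rightarrow> mpseries" where
  "hom_int n = (if n < 0 then 0 else complete_hom (nat n))"

lemma hom_int_of_nat [simp]: "hom_int (int n) = complete_hom n"
  by (simp add: hom_int_def)

lemma complete_hom_0 [simp]: "complete_hom 0 = 1"
  by (rule mpseries_eqI) (simp add: complete_hom.rep_eq one_mpseries.rep_eq)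

lemma h_perp_hom_int: "h_perp k (hom_int n) = hom_int (n - int k)"
  by (rule mpseries_eqI)
     (auto simp: hom_int_def mcoeff_simps complete_hom.rep_eq)

text \<open>The product rule iterated: \<open>k\<close> is distributed over the factors in all ways,
  and each factor is lowered by its share.\<close>

lemma h_perp_prod_hom_int:
  assumes "finite I"
  shows "h_perp k (\<Prod>i\<in>I. hom_int (w i)) = (\<Sum>a\<in>weak_comps I k. \<Prod>i\<in>I. hom_int (w i - int (a i)))"
  using assms
proof (induction I arbitrary: k)
  case empty
  then show ?case by (simp add: weak_comps_empty h_perp_1)
next
  case (insert x I)
  have upd: "(\<Prod>i\<in>I. hom_int (w i - int (if i = x then j else a i))) =
      (\<Prod>i\<in>I. hom_int (w i - int (a i)))" for a j
    by (rule prod.cong) (use insert in auto)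
  show ?case using insert
    by (simp add: h_perp_mult h_perp_hom_int sum_weak_comps_insert upd sum_distrib_left)
qed

lemma complete_hom_list_eq_prod:
  "complete_hom_list \<beta> = (\<Prod>i<length \<beta>. hom_int (int (\<beta> ! i)))"
  by (induction \<beta>) (simp_all add: complete_hom_list_def prod.lessThan_Suc_shift del: prod.lessThan_Suc)

text \<open>A series is determined by its constant term and its images under all
  \<open>h_perp k\<close>. Two families with equal constant terms on which these operators act in
  the same way therefore agree.\<close>

lemma mpseries_eq_by_h_perp:
  fixes F G :: "'a \<Rightarrow> mpseries"
  assumes base: "\<And>s. mcoeff (F s) {#} = mcoeff (G s) {#}"
    and step: "\<And>s k. (h_perp k (F s) = 0 \<and> h_perp k (G s) = 0) \<or>
      (\<exists>t. h_perp k (F s) = F t \<and> h_perp k (G s) = G t)"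
  shows "F s = G s"
proof (rule mpseries_eqI)
  fix M
  show "mcoeff (F s) M = mcoeff (G s) M"
  \<comment> \<open>Weighting by \<open>Suc i\<close> makes the measure drop both when a variable
    with index 0 is removed and when an index is lowered; the degree alone would not drop if
    \<open>count M 0 = 0\<close>.\<close>
  proof (induction "\<Sum>i\<in>#M. Suc i" arbitrary: M s rule: less_induct)
    case less
    show ?case
    proof (cases "M = {#}")
      case False
      let ?k = "count M 0" and ?N = "shift_down M"
      have M: "M = replicate_mset ?k 0 + image_mset Suc ?N" by (rule shift_down_split)
      have weight: "(\<Sum>i\<in>#M. Suc i) = ?k + ((\<Sum>i\<in>#?N. Suc i) + size ?N)"
      proof -
        have "(\<Sum>i\<in>#image_mset Suc N. Suc i) = (\<Sum>i\<in>#N. Suc i) + size N" for N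
          by (induction N) auto
        then show ?thesis by (subst (1) M) (simp del: image_mset.compositionality)
      qed
      have "?k + size ?N = size M" by (subst (3) M) simp
      then have "?k + size ?N > 0" using False by (metis nonempty_has_size)
      then have smaller: "(\<Sum>i\<in>#?N. Suc i) < (\<Sum>i\<in>#M. Suc i)" unfolding weight by linarith
      have "mcoeff (h_perp ?k (F s)) ?N = mcoeff (h_perp ?k (G s)) ?N"
        using step[of ?k s] less.hyps[OF smaller] by auto
      then show ?thesis using M by (simp add: h_perp.rep_eq)
    qed (use base less in auto)
  qed
qed

section \<open>The expansion over tuples\<close>

text \<open>This is \<open>R\<^sub>m\<close>. Its tuples are functions vanishing outside
  \<open>{..<r}\<close>, so that shifting a tuple is pointwise addition.\<close>

definition signed_hom_sum :: "nat \<Rightarrow> nat \<Rightarrow> mpseries" where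
  "signed_hom_sum r m = (\<Sum>w\<in>weak_comps {..<r} m.
    of_int (residue_sign r (\<lambda>i. w i + i)) *\<^sub>Q (\<Prod>i<r. complete_hom (w i)))"

text \<open>Lowering \<open>w\<close> by \<open>a\<close> and substituting \<open>u = w - a\<close>
  moves the shift from the product into the sign. The sum over \<open>a\<close> then involves signs
  only and is evaluated by \<open>sum_residue_sign_weak_comps\<close>.\<close>

lemma h_perp_signed_hom_sum:
  assumes "r > 0"
  shows "h_perp k (signed_hom_sum r m) =
    (if r dvd k \<and> k \<le> m then signed_hom_sum r (m - k) else 0)"
proof -
  let ?W = "weak_comps {..<r}"
  let ?c = "\<lambda>w. of_int (residue_sign r (\<lambda>i. w i + i)) :: rat"
  let ?H = "\<lambda>w. \<Prod>i<r. complete_hom (w i)"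
  \<comment> \<open>Terms with some \<open>w i < a i\<close> contain a factor of negative index and
    vanish; the others correspond to \<open>u = w - a\<close>. None remain if
    \<open>k > m\<close>.\<close>
  have shift: "(\<Sum>w\<in>?W m. ?c w *\<^sub>Q (\<Prod>i<r. hom_int (int (w i) - int (a i)))) =
      (if k \<le> m then \<Sum>u\<in>?W (m - k). ?c (\<lambda>i. u i + a i) *\<^sub>Q ?H u else 0)"
    if a: "a \<in> ?W k" for a
  proof -
    let ?D = "{w \<in> ?W m. \<forall>i<r. a i \<le> w i}"
    have "(\<Sum>w\<in>?W m. ?c w *\<^sub>Q (\<Prod>i<r. hom_int (int (w i) - int (a i)))) =
        (\<Sum>w\<in>?D. ?c w *\<^sub>Q ?H (\<lambda>i. w i - a i))"
    proof (rule sum.mono_neutral_cong_right)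
      show "\<forall>w\<in>?W m - ?D. ?c w *\<^sub>Q (\<Prod>i<r. hom_int (int (w i) - int (a i))) = 0"
      proof
        fix w assume "w \<in> ?W m - ?D"
        then obtain i where "i < r" "w i < a i" by (auto simp: not_le)
        then have "(\<Prod>i<r. hom_int (int (w i) - int (a i))) = 0"
          by (intro prod_zero) (auto simp: hom_int_def intro!: bexI[of _ i])
        then show "?c w *\<^sub>Q (\<Prod>i<r. hom_int (int (w i) - int (a i))) = 0" by simp
      qed
      fix w assume "w \<in> ?D"
      then have "(\<Prod>i<r. hom_int (int (w i) - int (a i))) = ?H (\<lambda>i. w i - a i)"
        by (intro prod.cong) (auto simp: hom_int_def nat_diff_distrib)
      then show "?c w *\<^sub>Q (\<Prod>i<r. hom_int (int (w i) - int (a i))) = ?c w *\<^sub>Q ?H (\<lambda>i. w i - a i)"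
        by simp
    qed auto
    also have "\<dots> = (if k \<le> m then \<Sum>u\<in>?W (m - k). ?c (\<lambda>i. u i + a i) *\<^sub>Q ?H u else 0)"
    proof (cases "k \<le> m")
      case True
      have undo: "(\<lambda>i. w i - a i + a i) = w" if "w \<in> ?D" for w
      proof
        fix i show "w i - a i + a i = w i"
          using that a by (cases "i < r") (auto simp: weak_comps_def)
      qed
      have diff: "(\<Sum>i<r. w i - a i) = sum w {..<r} - sum a {..<r}" if "w \<in> ?D" for w
        by (rule sum_subtractf_nat) (use that in auto)
      have "(\<Sum>w\<in>?D. ?c w *\<^sub>Q ?H (\<lambda>i. w i - a i)) =
          (\<Sum>u\<in>?W (m - k). ?c (\<lambda>i. u i + a i) *\<^sub>Q ?H u)"
      proof (rule sum.reindex_bij_witness[where j = "\<lambda>w i. w i - a i" and i = "\<lambda>u i. u i + a i"])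
        fix w assume w: "w \<in> ?D"
        show "(\<lambda>i. w i - a i + a i) = w" by (rule undo[OF w])
        show "(\<lambda>i. w i - a i) \<in> ?W (m - k)"
          using w a by (auto simp: weak_comps_def diff)
        show "?c (\<lambda>i. w i - a i + a i) *\<^sub>Q ?H (\<lambda>i. w i - a i) = ?c w *\<^sub>Q ?H (\<lambda>i. w i - a i)"
          by (simp only: undo[OF w] fun_cong[OF undo[OF w]])
      qed (use a True in \<open>auto simp: weak_comps_def sum.distrib\<close>)
      then show ?thesis using True by simp
    next
      case False
      have "sum a {..<r} \<le> sum w {..<r}" if "w \<in> ?D" for w
        by (rule sum_mono) (use that in auto)
      then have "?D = {}" using a False by (fastforce simp: weak_comps_def)
      then show ?thesis using False by (simp only: sum.empty if_False)
    qed
    finally show ?thesis .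
  qed
  have "h_perp k (signed_hom_sum r m) =
      (\<Sum>w\<in>?W m. ?c w *\<^sub>Q h_perp k (\<Prod>i<r. hom_int (int (w i))))"
    by (simp add: signed_hom_sum_def h_perp_sum h_perp_scale)
  also have "\<dots> = (\<Sum>w\<in>?W m. \<Sum>a\<in>?W k. ?c w *\<^sub>Q (\<Prod>i<r. hom_int (int (w i) - int (a i))))"
    by (subst h_perp_prod_hom_int) (simp_all add: scale_sum_right)
  also have "\<dots> = (\<Sum>a\<in>?W k. if k \<le> m then \<Sum>u\<in>?W (m - k). ?c (\<lambda>i. u i + a i) *\<^sub>Q ?H u else 0)"
    by (subst sum.swap) (rule sum.cong[OF refl shift])
  also have "\<dots> = (if r dvd k \<and> k \<le> m then signed_hom_sum r (m - k) else 0)"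
  proof (cases "k \<le> m")
    case True
    have "(\<Sum>a\<in>?W k. \<Sum>u\<in>?W (m - k). ?c (\<lambda>i. u i + a i) *\<^sub>Q ?H u) =
        (\<Sum>u\<in>?W (m - k). of_int (\<Sum>a\<in>?W k. residue_sign r (\<lambda>i. (u i + i) + a i)) *\<^sub>Q ?H u)"
      by (subst sum.swap) (simp add: scale_sum_left add.commute add.left_commute)
    also have "\<dots> = (\<Sum>u\<in>?W (m - k). (if r dvd k then ?c u else 0) *\<^sub>Q ?H u)"
      using assms by (simp add: sum_residue_sign_weak_comps del: scale_0 cong: if_cong) (simp only: if_distrib[of rat_of_int] of_int_0)
    finally show ?thesis using True by (simp add: signed_hom_sum_def)
  qed simp
  finally show ?thesis .
qed

section \<open>Constant terms\<close>

lemma mcoeff_prod_hom_empty: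
  assumes "finite I"
  shows "mcoeff (\<Prod>i\<in>I. complete_hom (w i)) {#} = (if \<forall>i\<in>I. w i = 0 then 1 else 0)"
proof -
  have "{(A, B). A + B = {#}} = {({#}, {#} :: nat multiset)}" by auto
  then have mult: "mcoeff (f * g) {#} = mcoeff f {#} * mcoeff g {#}" for f g
    by (simp add: times_mpseries.rep_eq)
  show ?thesis using assms
    by (induction I) (auto simp: mult mcoeff_simps complete_hom.rep_eq)
qed

lemma residue_sign_id: "residue_sign r (\<lambda>i. i) = 1"
  unfolding residue_sign_def by (rule prod.neutral) auto

text \<open>A nonzero entry gives a factor without constant term, so only the zero tuple
  contributes, with the sign 1 of the residues in increasing order.\<close>

lemma mcoeff_signed_hom_sum_empty: "mcoeff (signed_hom_sum r m) {#} = (if m = 0 then 1 else 0)"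
proof -
  have "\<exists>i<r. w i \<noteq> 0" if "w \<in> weak_comps {..<r} m" "m > 0" for w
    using that by (auto simp: weak_comps_def simp del: sum_eq_0_iff intro: ccontr dest!: sum.neutral)
  then show ?thesis
    by (fastforce simp: signed_hom_sum_def mcoeff_sum mcoeff_simps mcoeff_prod_hom_empty
        residue_sign_id intro!: sum.neutral)
qed

section \<open>Plethysm with a power sum, and its agreement with the sum over tuples\<close>

lemma mcoeff_plethysm_power_sum:
  assumes "r > 0"
  shows "mcoeff (plethysm_power_sum f r) (repeat_mset r N) = mcoeff f N"
proof -
  have "{N'. repeat_mset r N' = repeat_mset r N} = {N}"
    using assms by (auto simp: multiset_eq_iff)
  then show ?thesis by (simp add: plethysm_power_sum.rep_eq)
qed

lemma mcoeff_plethysm_power_sum_eq_0: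
  assumes "M \<notin> range (repeat_mset r)"
  shows "mcoeff (plethysm_power_sum f r) M = 0"
proof -
  have "{N. repeat_mset r N = M} = {}" using assms by auto
  then show ?thesis by (simp add: plethysm_power_sum.rep_eq del: Collect_empty_eq)
qed

text \<open>A monomial is an \<open>r\<close>-th power exactly if its power of the first variable
  and its remaining part both are.\<close>

lemma h_perp_plethysm_power_sum:
  assumes "r > 0"
  shows "h_perp k (plethysm_power_sum f r) =
    (if r dvd k then plethysm_power_sum (h_perp (k div r) f) r else 0)"
proof (rule mpseries_eqI)
  fix M
  let ?M = "replicate_mset k 0 + image_mset Suc M"
  have decomp: "r dvd k \<and> M = repeat_mset r (shift_down N)" if "?M = repeat_mset r N" for N
  proof -
    have "count ?M 0 = r * count N 0" "count M i = r * count (shift_down N) i" for i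
    proof -
      show "count ?M 0 = r * count N 0" using that by simp
      have "repeat_mset r N = repeat_mset r (replicate_mset (count N 0) 0 + image_mset Suc (shift_down N))"
        by (subst (1) shift_down_split[of N]) simp
      also have "\<dots> = repeat_mset r (replicate_mset (count N 0) 0) + image_mset Suc (repeat_mset r (shift_down N))"
        by (induction r) (simp_all add: ac_simps)
      finally have "shift_down ?M = shift_down (\<dots>)" using that by simp
      moreover have "shift_down (repeat_mset r (replicate_mset (count N 0) 0)) = {#}"
        by (induction r) auto
      ultimately have "M = repeat_mset r (shift_down N)" by simp
      then show "count M i = r * count (shift_down N) i" by simp
    qed
    then show ?thesis by (auto simp: multiset_eq_iff)
  qed
  show "mcoeff (h_perp k (plethysm_power_sum f r)) M =
    mcoeff (if r dvd k then plethysm_power_sum (h_perp (k div r) f) r else 0) M"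
  proof (cases "r dvd k \<and> M \<in> range (repeat_mset r)")
    case True
    then obtain j N where k: "k = r * j" and M: "M = repeat_mset r N" by blast
    have "?M = repeat_mset r (replicate_mset j 0 + image_mset Suc N)"
      unfolding k M by (induction r) (simp_all add: ac_simps replicate_mset_add)
    then have "mcoeff (h_perp k (plethysm_power_sum f r)) M =
        mcoeff f (replicate_mset j 0 + image_mset Suc N)"
      unfolding h_perp.rep_eq by (simp only: mcoeff_plethysm_power_sum[OF assms])
    then show ?thesis
      using assms by (simp add: h_perp.rep_eq mcoeff_plethysm_power_sum k M)
  next
    case False
    then have "?M \<notin> range (repeat_mset r)" using decomp by blast
    then show ?thesis using False
      by (auto simp: h_perp.rep_eq mcoeff_plethysm_power_sum_eq_0 mcoeff_simps)
  qed
qed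

lemma plethysm_power_sum_0 [simp]: "plethysm_power_sum 0 r = 0"
  by (rule mpseries_eqI) (simp add: plethysm_power_sum.rep_eq mcoeff_simps)

text \<open>On both sides \<open>h_perp (r * j)\<close> replaces \<open>n\<close> by
  \<open>n - j\<close>, or gives 0 if \<open>j > n\<close>, and \<open>h_perp k\<close> gives 0 if
  \<open>r\<close> does not divide \<open>k\<close>; the constant terms agree.\<close>

lemma plethysm_power_sum_hom_eq_signed_hom_sum:
  assumes "r > 0"
  shows "plethysm_power_sum (complete_hom n) r = signed_hom_sum r (n * r)"
proof (rule mpseries_eq_by_h_perp[where F = "\<lambda>n. plethysm_power_sum (complete_hom n) r"
      and G = "\<lambda>n. signed_hom_sum r (n * r)"])
  fix n k
  show "mcoeff (plethysm_power_sum (complete_hom n) r) {#} = mcoeff (signed_hom_sum r (n * r)) {#}"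
    using mcoeff_plethysm_power_sum[OF assms, of "complete_hom n" "{#}"] assms
    by (simp add: mcoeff_signed_hom_sum_empty complete_hom.rep_eq)
  have h: "h_perp j (complete_hom n) = (if j \<le> n then complete_hom (n - j) else 0)" for j
    using h_perp_hom_int[of j "int n"] by (auto simp: hom_int_def nat_diff_distrib)
  show "(h_perp k (plethysm_power_sum (complete_hom n) r) = 0 \<and> h_perp k (signed_hom_sum r (n * r)) = 0) \<or>
    (\<exists>t. h_perp k (plethysm_power_sum (complete_hom n) r) = plethysm_power_sum (complete_hom t) r \<and>
       h_perp k (signed_hom_sum r (n * r)) = signed_hom_sum r (t * r))"
  proof (cases "r dvd k")
    case True
    then obtain j where "k = r * j" by auto
    then show ?thesis using assms
      by (auto simp: h_perp_plethysm_power_sum h_perp_signed_hom_sum h mult.commute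
          diff_mult_distrib2 intro!: exI[of _ "n - j"])
  qed (use assms in \<open>simp add: h_perp_plethysm_power_sum h_perp_signed_hom_sum\<close>)
qed

section \<open>Linear independence of the products of complete homogeneous functions\<close>

lemma mult_scale_right: "f * (c *\<^sub>Q g) = c *\<^sub>Q (f * g)"
  by (rule mpseries_eqI)
     (simp add: mcoeff_simps times_mpseries.rep_eq sum_distrib_left case_prod_unfold mult.left_commute)

text \<open>The operator $e_m^\perp$, obtained from $\sum_j (-1)^j e_j h_{m-j} = 0$.\<close>

fun e_perp :: "nat \<Rightarrow> mpseries \<Rightarrow> mpseries" where
  "e_perp m f =
    (if m = 0 then f else \<Sum>j<m. (- 1) ^ (m + j + 1) * e_perp j (h_perp (m - j) f))"

declare e_perp.simps [simp del]

lemma e_perp_0_left [simp]: "e_perp 0 f = f"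
  by (simp add: e_perp.simps)

lemma e_perp_rec: "m > 0 \<Longrightarrow> e_perp m f = (\<Sum>j<m. (- 1) ^ (m + j + 1) * e_perp j (h_perp (m - j) f))"
  by (subst e_perp.simps) simp

lemma e_perp_sum_scale: "e_perp m (\<Sum>x\<in>A. c x *\<^sub>Q F x) = (\<Sum>x\<in>A. c x *\<^sub>Q e_perp m (F x))"
proof (induction m arbitrary: F rule: less_induct)
  case (less m)
  show ?case
  proof (cases "m = 0")
    case False
    have "e_perp m (\<Sum>x\<in>A. c x *\<^sub>Q F x) =
        (\<Sum>j<m. (- 1) ^ (m + j + 1) * (\<Sum>x\<in>A. c x *\<^sub>Q e_perp j (h_perp (m - j) (F x))))"
      using False less by (simp add: e_perp_rec h_perp_sum h_perp_scale)
    also have "\<dots> = (\<Sum>x\<in>A. c x *\<^sub>Q e_perp m (F x))"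
      unfolding sum_distrib_left mult_scale_right
      by (subst sum.swap) (use False in \<open>simp add: e_perp_rec scale_sum_right\<close>)
    finally show ?thesis .
  qed simp
qed

lemma e_perp_sum: "e_perp m (\<Sum>x\<in>A. F x) = (\<Sum>x\<in>A. e_perp m (F x))"
  using e_perp_sum_scale[of m "\<lambda>_. 1"] by simp

lemma e_perp_0_right [simp]: "e_perp m 0 = 0"
  using e_perp_sum[of m _ "{}"] by simp

text \<open>The right side satisfies the recursion defining \<open>e_perp\<close>: this is
  \<open>alternating_sum_weak_comps\<close>, applied to the product lowered by a tuple
  \<open>b\<close> and solved for the term \<open>j = m\<close>.\<close>

lemma e_perp_prod_hom_int:
  assumes "finite I"
  shows "e_perp m (\<Prod>i\<in>I. hom_int (w i)) =
    (\<Sum>S | S \<subseteq> I \<and> card S = m. \<Prod>i\<in>I. hom_int (w i - of_bool (i \<in> S)))"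
proof (induction m arbitrary: w rule: less_induct)
  case (less m)
  have sub0: "{S. S \<subseteq> I \<and> card S = 0} = {{}}" using assms finite_subset by fastforce
  show ?case
  proof (cases "m = 0")
    case True
    then show ?thesis by (simp add: sub0 del: card_0_eq)
  next
    case False
    \<comment> \<open>The indices are lowered by \<open>a\<close> through
      \<open>h_perp (m - j)\<close> and by the indicator of \<open>S\<close> through
      \<open>e_perp j\<close>. For \<open>j = m\<close> only \<open>a = 0\<close> is left, so
      \<open>Y m\<close> is the claimed sum.\<close>
    define Y where "Y j = (\<Sum>S | S \<subseteq> I \<and> card S = j. \<Sum>a\<in>weak_comps I (m - j).
      \<Prod>i\<in>I. hom_int (w i - int (a i + of_bool (i \<in> S))))" for j
    have Y: "e_perp j (h_perp (m - j) (\<Prod>i\<in>I. hom_int (w i))) = Y j" if "j < m" for j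
      unfolding Y_def
      by (subst sum.swap)
         (simp add: h_perp_prod_hom_int[OF assms] e_perp_sum less.IH[OF that] diff_diff_eq)
    have "0 = (\<Sum>j\<le>m. (- 1) ^ j * Y j)"
      unfolding Y_def
      by (rule alternating_sum_weak_comps[symmetric,
            where f = "\<lambda>b. \<Prod>i\<in>I. hom_int (w i - int (b i))"]) (use assms False in auto)
    also have "\<dots> = (\<Sum>j<m. (- 1) ^ j * Y j) + (- 1) ^ m * Y m"
      by (simp add: lessThan_Suc_atMost[symmetric])
    \<comment> \<open>Multiplying by this sign turns the coefficient of \<open>Y m\<close> into
      1.\<close>
    finally have "(- 1) ^ m * ((\<Sum>j<m. (- 1) ^ j * Y j) + (- 1) ^ m * Y m) = 0" by simp
    then have "Y m = - ((- 1) ^ m * (\<Sum>j<m. (- 1) ^ j * Y j))"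
      by (simp add: distrib_left mult.assoc[symmetric] power_mult_distrib[symmetric] add_eq_0_iff)
    also have "\<dots> = e_perp m (\<Prod>i\<in>I. hom_int (w i))"
      using False by (simp add: e_perp_rec Y sum_distrib_left power_add mult.assoc sum_negf)
    finally show ?thesis by (simp add: Y_def assms)
  qed
qed

section \<open>Removing and adding the first column of a Young diagram\<close>

definition strip_column :: "nat list \<Rightarrow> nat list" where
  "strip_column \<mu> = filter (\<lambda>x. x \<noteq> 0) (map (\<lambda>x. x - 1) \<mu>)"

text \<open>Rows of length 1 disappear when the first column is stripped, so the number
  \<open>l\<close> of rows has to be supplied to restore them.\<close>

definition add_column :: "nat \<Rightarrow> nat list \<Rightarrow> nat list" where
  "add_column l \<nu> = map Suc \<nu> @ replicate (l - length \<nu>) 1"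

lemma length_strip_column: "length (strip_column \<mu>) \<le> length \<mu>"
  unfolding strip_column_def by (metis length_filter_le length_map)

lemma sum_list_strip_column: "0 \<notin> set \<mu> \<Longrightarrow> sum_list (strip_column \<mu>) + length \<mu> = sum_list \<mu>"
  by (induction \<mu>) (auto simp: strip_column_def)

text \<open>In a weakly decreasing list the parts equal to 1 stand at the end, where
  \<open>add_column\<close> puts them back.\<close>

lemma add_column_strip_column:
  "0 \<notin> set \<mu> \<Longrightarrow> sorted_wrt (\<ge>) \<mu> \<Longrightarrow> add_column (length \<mu>) (strip_column \<mu>) = \<mu>"
proof (induction \<mu>)
  case (Cons x \<mu>)
  show ?case
  proof (cases "x = 1")
    case True
    then have ones: "y = 1" if "y \<in> set \<mu>" for y
      using Cons.prems that by (metis One_nat_def le_antisym less_one not_le list.set_intros(2) sorted_wrt.simps(2))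
    then have "strip_column (x # \<mu>) = []" using True by (auto simp: strip_column_def)
    moreover have "replicate (length \<mu>) 1 = \<mu>" using ones by (intro replicate_eqI[symmetric]) auto
    ultimately show ?thesis using True by (simp add: add_column_def)
  next
    case False
    then show ?thesis using Cons by (auto simp: add_column_def strip_column_def)
  qed
qed (simp add: add_column_def strip_column_def)

lemma strip_column_add_column: "0 \<notin> set \<nu> \<Longrightarrow> strip_column (add_column l \<nu>) = \<nu>"
  by (auto simp: strip_column_def add_column_def comp_def filter_id_conv intro: gr0I)

lemma strip_column_partition:
  assumes "\<mu> \<in> partitions m"
  shows "strip_column \<mu> \<in> partitions (m - length \<mu>)"
proof -
  have "sum_list (strip_column \<mu>) = m - length \<mu>"
    using assms sum_list_strip_column[of \<mu>] by (auto simp: partitions_def compositions_def)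
  moreover have "sorted_wrt (\<ge>) (strip_column \<mu>)"
    unfolding strip_column_def
    by (intro sorted_wrt_filter) (use assms in \<open>auto simp: partitions_def sorted_wrt_map intro: sorted_wrt_mono_rel[rotated]\<close>)
  ultimately show ?thesis by (auto simp: partitions_def compositions_def strip_column_def)
qed

lemma add_column_partition:
  assumes "\<nu> \<in> partitions (m - l)" "length \<nu> \<le> l" "l \<le> m"
  shows "add_column l \<nu> \<in> partitions m"
proof -
  have "sum_list (map Suc \<nu>) = sum_list \<nu> + length \<nu>" by (induction \<nu>) auto
  moreover have "sorted_wrt (\<ge>) (replicate k (1 :: nat))" for k by (induction k) auto
  ultimately show ?thesis using assms
    by (auto simp: partitions_def compositions_def add_column_def sorted_wrt_append sorted_wrt_map
        sum_list_replicate)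
qed

lemma length_le_sum_list: "0 \<notin> set \<mu> \<Longrightarrow> length \<mu> \<le> sum_list (\<mu> :: nat list)"
  using sum_list_strip_column[of \<mu>] by linarith

lemma complete_hom_list_filter:
  "complete_hom_list (filter (\<lambda>x. x \<noteq> 0) w) = complete_hom_list w"
  by (induction w) (auto simp: complete_hom_list_def)

lemma finite_partitions: "finite (partitions m)"
  by (rule finite_subset[OF _ finite_compositions]) (auto simp: partitions_def)

text \<open>A set of \<open>l\<close> factors to be lowered must be the set of all factors, and
  there is none if \<open>length \<mu> < l\<close>. The factors lowered to index 0 become 1 and can
  be deleted.\<close>

lemma e_perp_complete_hom_list:
  assumes "length \<mu> \<le> l" "0 \<notin> set \<mu>"
  shows "e_perp l (complete_hom_list \<mu>) =
    (if length \<mu> = l then complete_hom_list (strip_column \<mu>) else 0)"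
proof (cases "length \<mu> = l")
  case True
  have all: "{S. S \<subseteq> {..<l} \<and> card S = l} = {{..<l}}" using card_subset_eq[of "{..<l}"] by auto
  have "e_perp l (complete_hom_list \<mu>) = (\<Prod>i<l. hom_int (int (\<mu> ! i) - of_bool (i < l)))"
    using True by (simp add: complete_hom_list_eq_prod e_perp_prod_hom_int all del: hom_int_of_nat)
  also have "\<dots> = (\<Prod>i<l. hom_int (int (map (\<lambda>x. x - 1) \<mu> ! i)))"
  proof (rule prod.cong)
    fix i assume "i \<in> {..<l}"
    then have "\<mu> ! i \<noteq> 0" "i < length \<mu>" using assms True by (metis lessThan_iff nth_mem)+
    then show "hom_int (int (\<mu> ! i) - of_bool (i < l)) = hom_int (int (map (\<lambda>x. x - 1) \<mu> ! i))"
      using True by (simp add: of_nat_diff)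
  qed simp
  also have "\<dots> = complete_hom_list (map (\<lambda>x. x - 1) \<mu>)"
    using True by (simp add: complete_hom_list_eq_prod)
  finally show ?thesis using True by (simp only: strip_column_def complete_hom_list_filter refl if_True)
next
  case False
  then have "card S \<noteq> l" if S: "S \<subseteq> {..<length \<mu>}" for S
    using card_mono[OF _ S] assms by simp
  then have "{S. S \<subseteq> {..<length \<mu>} \<and> card S = l} = {}" by blast
  then show ?thesis using False
    by (simp only: complete_hom_list_eq_prod e_perp_prod_hom_int finite_lessThan sum.empty if_False)
qed

text \<open>Applying $e_l^\perp$ for the largest length \<open>l\<close> occurring in a relation kills all shorter
  terms and removes the first column of the partitions of length \<open>l\<close>.\<close>

lemma complete_hom_list_independent:
  assumes "(\<Sum>\<mu>\<in>partitions m. c \<mu> *\<^sub>Q complete_hom_list \<mu>) = 0" "\<mu> \<in> partitions m"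
  shows "c \<mu> = 0"
  using assms
proof (induction m arbitrary: c \<mu> rule: less_induct)
  case (less m)
  show ?case
  proof (cases "m = 0")
    case True
    have p0: "partitions m = {[]}"
      unfolding True by (auto simp: partitions_def compositions_def)
        (metis list.set_intros(1) neq_Nil_conv)
    then have "mcoeff (c [] *\<^sub>Q 1) {#} = 0"
      using less.prems by (simp add: complete_hom_list_def mcoeff_simps)
    then show ?thesis using less.prems p0 by (simp add: mcoeff_simps)
  next
    case False
    show ?thesis
    proof (rule ccontr)
      assume "c \<mu> \<noteq> 0"
      define B where "B = {\<mu> \<in> partitions m. c \<mu> \<noteq> 0}"
      define l where "l = Max (length ` B)"
      have B: "finite B" "B \<noteq> {}"
        using less.prems \<open>c \<mu> \<noteq> 0\<close> by (auto simp: B_def finite_partitions)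
      then have "l \<in> length ` B" unfolding l_def by (intro Max_in) auto
      then obtain \<kappa> where \<kappa>: "\<kappa> \<in> partitions m" "c \<kappa> \<noteq> 0" "length \<kappa> = l" by (auto simp: B_def)
      have max: "length \<nu> \<le> l" if "\<nu> \<in> partitions m" "c \<nu> \<noteq> 0" for \<nu>
        using that B by (auto simp: l_def B_def)
      have "0 < l" "l \<le> m"
        using \<kappa> False length_le_sum_list[of \<kappa>] by (auto simp: partitions_def compositions_def)
      let ?P = "{\<nu> \<in> partitions m. length \<nu> = l}" and ?Q = "{\<nu> \<in> partitions (m - l). length \<nu> \<le> l}"
      \<comment> \<open>The coefficients of a relation in degree \<open>m - l\<close>. A partition
        with more than \<open>l\<close> parts does not arise by stripping one with \<open>l\<close>
        parts, hence the value 0.\<close>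
      let ?d = "\<lambda>\<nu>. if length \<nu> \<le> l then c (add_column l \<nu>) else 0"
      have "0 = e_perp l (\<Sum>\<nu>\<in>partitions m. c \<nu> *\<^sub>Q complete_hom_list \<nu>)"
        using less.prems by simp
      also have "\<dots> = (\<Sum>\<nu>\<in>partitions m. c \<nu> *\<^sub>Q e_perp l (complete_hom_list \<nu>))"
        by (rule e_perp_sum_scale)
      \<comment> \<open>Shorter partitions are killed by \<open>e_perp l\<close>, longer ones have
        coefficient 0 by maximality of \<open>l\<close>.\<close>
      also have "\<dots> = (\<Sum>\<nu>\<in>?P. c \<nu> *\<^sub>Q complete_hom_list (strip_column \<nu>))"
      proof (rule sum.mono_neutral_cong_right)
        show "\<forall>\<nu>\<in>partitions m - ?P. c \<nu> *\<^sub>Q e_perp l (complete_hom_list \<nu>) = 0"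
        proof
          fix \<nu> assume "\<nu> \<in> partitions m - ?P"
          then show "c \<nu> *\<^sub>Q e_perp l (complete_hom_list \<nu>) = 0"
            using max[of \<nu>] e_perp_complete_hom_list[of \<nu> l]
            by (cases "c \<nu> = 0") (auto simp: partitions_def compositions_def)
        qed
      qed (use finite_partitions in
          \<open>auto simp: e_perp_complete_hom_list partitions_def compositions_def\<close>)
      also have "\<dots> = (\<Sum>\<nu>\<in>?Q. c (add_column l \<nu>) *\<^sub>Q complete_hom_list \<nu>)"
      proof (rule sum.reindex_bij_witness[where i = "add_column l" and j = strip_column])
        fix \<nu> assume \<nu>: "\<nu> \<in> ?P"
        show inv: "add_column l (strip_column \<nu>) = \<nu>"
          using \<nu> add_column_strip_column[of \<nu>] by (auto simp: partitions_def compositions_def)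
        show "strip_column \<nu> \<in> ?Q"
          using \<nu> strip_column_partition[of \<nu> m] length_strip_column[of \<nu>] by auto
        show "c (add_column l (strip_column \<nu>)) *\<^sub>Q complete_hom_list (strip_column \<nu>) =
            c \<nu> *\<^sub>Q complete_hom_list (strip_column \<nu>)"
          by (simp add: inv)
      next
        fix \<nu> assume \<nu>: "\<nu> \<in> ?Q"
        show "strip_column (add_column l \<nu>) = \<nu>"
          using \<nu> by (intro strip_column_add_column) (auto simp: partitions_def compositions_def)
        show "add_column l \<nu> \<in> ?P"
          using \<nu> \<open>l \<le> m\<close> add_column_partition[of \<nu> m l] by (auto simp: add_column_def)
      qed
      also have "\<dots> = (\<Sum>\<nu>\<in>partitions (m - l). ?d \<nu> *\<^sub>Q complete_hom_list \<nu>)"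
        by (rule sum.mono_neutral_cong_left) (auto simp: finite_partitions)
      finally have zero: "(\<Sum>\<nu>\<in>partitions (m - l). ?d \<nu> *\<^sub>Q complete_hom_list \<nu>) = 0" by simp
      have "strip_column \<kappa> \<in> partitions (m - l)"
        using \<kappa> strip_column_partition by blast
      \<comment> \<open>Since \<open>l > 0\<close> the degree has dropped, so the induction
        hypothesis forces \<open>c \<kappa> = 0\<close>, against the choice of
        \<open>\<kappa>\<close>.\<close>
      then have "?d (strip_column \<kappa>) = 0"
        using \<open>0 < l\<close> False by (intro less.IH[OF _ zero]) auto
      then have "c (add_column l (strip_column \<kappa>)) = 0"
        using length_strip_column[of \<kappa>] \<kappa> by simp
      moreover have "add_column l (strip_column \<kappa>) = \<kappa>"
        using \<kappa> add_column_strip_column[of \<kappa>] by (auto simp: partitions_def compositions_def)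
      ultimately show False using \<kappa> by simp
    qed
  qed
qed

section \<open>Collecting tuples into compositions and partitions\<close>

text \<open>Tuples are grouped by the composition left after deleting zeros, which does not change
  the product because \<open>complete_hom 0 = 1\<close>.\<close>

lemma sum_shat_composition_eq_signed_hom_sum:
  "(\<Sum>\<beta>\<in>compositions m. of_int (shat_composition r \<beta>) *\<^sub>Q complete_hom_list \<beta>) = signed_hom_sum r m"
proof -
  let ?L = "{w :: nat list. length w = r \<and> sum_list w = m}"
  let ?nz = "filter (\<lambda>x. x \<noteq> (0::nat))"
  have finL: "finite ?L"
    by (rule finite_subset[of _ "{w. set w \<subseteq> {..m} \<and> length w = r}"])
       (auto simp: finite_lists_length_eq intro: member_le_sum_list)
  have sum_nz: "sum_list (?nz w) = sum_list w" for w by (induction w) auto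
  have shat: "shat_composition r \<beta> = (\<Sum>w | w \<in> ?L \<and> ?nz w = \<beta>. shat_tuple w)"
    if "\<beta> \<in> compositions m" for \<beta>
  proof -
    have "{w. w \<in> ?L \<and> ?nz w = \<beta>} = {w. length w = r \<and> ?nz w = \<beta>}"
      using that sum_nz by (auto simp: compositions_def)
    \<comment> \<open>Deleting zeros never lengthens a list, so the value 0 prescribed for
      \<open>length \<beta> > r\<close> is an empty sum.\<close>
    moreover have "{w. length w = r \<and> ?nz w = \<beta>} = {}" if "\<not> length \<beta> \<le> r"
      using that length_filter_le by blast
    ultimately show ?thesis by (simp add: shat_composition_def del: Collect_empty_eq)
  qed
  have "(\<Sum>\<beta>\<in>compositions m. of_int (shat_composition r \<beta>) *\<^sub>Q complete_hom_list \<beta>) =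
      (\<Sum>\<beta>\<in>compositions m. \<Sum>w | w \<in> ?L \<and> ?nz w = \<beta>. of_int (shat_tuple w) *\<^sub>Q complete_hom_list w)"
  proof (rule sum.cong[OF refl])
    fix \<beta> assume "\<beta> \<in> compositions m"
    then have "of_int (shat_composition r \<beta>) *\<^sub>Q complete_hom_list \<beta> =
        (\<Sum>w | w \<in> ?L \<and> ?nz w = \<beta>. of_int (shat_tuple w) *\<^sub>Q complete_hom_list \<beta>)"
      by (simp only: shat of_int_sum scale_sum_left)
    also have "\<dots> = (\<Sum>w | w \<in> ?L \<and> ?nz w = \<beta>. of_int (shat_tuple w) *\<^sub>Q complete_hom_list w)"
      by (rule sum.cong) (use complete_hom_list_filter in auto)
    finally show "of_int (shat_composition r \<beta>) *\<^sub>Q complete_hom_list \<beta> =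
        (\<Sum>w | w \<in> ?L \<and> ?nz w = \<beta>. of_int (shat_tuple w) *\<^sub>Q complete_hom_list w)" .
  qed
  also have "\<dots> = (\<Sum>w\<in>?L. of_int (shat_tuple w) *\<^sub>Q complete_hom_list w)"
    by (rule sum.group) (use finL finite_compositions sum_nz in \<open>auto simp: compositions_def\<close>)
  also have "\<dots> = signed_hom_sum r m"
    unfolding signed_hom_sum_def
  proof (rule sum.reindex_bij_witness[where i = "\<lambda>w. map w [0..<r]"
        and j = "\<lambda>xs i. if i < r then xs ! i else 0"])
    fix xs :: "nat list" assume xs: "xs \<in> ?L"
    let ?w = "\<lambda>i. if i < r then xs ! i else 0"
    show map: "map ?w [0..<r] = xs" using xs by (auto intro: nth_equalityI)
    show "?w \<in> weak_comps {..<r} m"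
      using xs by (auto simp: weak_comps_def sum_list_sum_nth atLeast0LessThan)
    have "shat_tuple xs = residue_sign r (\<lambda>i. ?w i + i)"
      using shat_tuple_eq_residue_sign[of ?w r] map by simp
    moreover have "complete_hom_list xs = (\<Prod>i<r. complete_hom (?w i))"
      using xs by (simp add: complete_hom_list_eq_prod)
    ultimately show "of_int (residue_sign r (\<lambda>i. ?w i + i)) *\<^sub>Q (\<Prod>i<r. complete_hom (?w i)) =
        of_int (shat_tuple xs) *\<^sub>Q complete_hom_list xs" by simp
  next
    fix w assume w: "w \<in> weak_comps {..<r} m"
    show "(\<lambda>i. if i < r then map w [0..<r] ! i else 0) = w"
      using w by (auto simp: weak_comps_def)
    show "map w [0..<r] \<in> ?L"
      using w by (auto simp: weak_comps_def interv_sum_list_conv_sum_set_nat atLeast0LessThan)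
  qed
  finally show ?thesis .
qed

lemma complete_hom_list_cong_mset:
  "mset \<beta> = mset \<gamma> \<Longrightarrow> complete_hom_list \<beta> = complete_hom_list \<gamma>"
  unfolding complete_hom_list_def by (metis mset_map prod_mset_prod_list)

text \<open>By commutativity the product depends only on the decreasing rearrangement, by which the
  compositions are grouped.\<close>

lemma sum_shat_composition_eq_sum_shat_partition:
  "(\<Sum>\<beta>\<in>compositions m. of_int (shat_composition r \<beta>) *\<^sub>Q complete_hom_list \<beta>) =
   (\<Sum>\<mu>\<in>partitions m. of_int (shat_partition r \<mu>) *\<^sub>Q complete_hom_list \<mu>)"
proof -
  let ?g = "\<lambda>\<beta> :: nat list. rev (sort \<beta>)"
  have "?g ` compositions m \<subseteq> partitions m"
  proof safe
    fix \<beta> assume "\<beta> \<in> compositions m"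
    moreover have "sum_list (?g \<beta>) = sum_list \<beta>"
      by (metis mset_rev mset_sort sum_mset_sum_list)
    ultimately show "?g \<beta> \<in> partitions m"
      using sorted_sort[of \<beta>]
      by (simp add: partitions_def compositions_def sorted_wrt_rev)
  qed
  then have "(\<Sum>\<beta>\<in>compositions m. of_int (shat_composition r \<beta>) *\<^sub>Q complete_hom_list \<beta>) =
      (\<Sum>\<mu>\<in>partitions m. \<Sum>\<beta> | \<beta> \<in> compositions m \<and> ?g \<beta> = \<mu>.
        of_int (shat_composition r \<beta>) *\<^sub>Q complete_hom_list \<beta>)"
    by (intro sum.group[symmetric] finite_compositions finite_partitions)
  also have "\<dots> = (\<Sum>\<mu>\<in>partitions m. of_int (shat_partition r \<mu>) *\<^sub>Q complete_hom_list \<mu>)"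
  proof (rule sum.cong[OF refl])
    fix \<mu> assume "\<mu> \<in> partitions m"
    then have m: "sum_list \<mu> = m" by (simp add: partitions_def compositions_def)
    have "(\<Sum>\<beta> | \<beta> \<in> compositions m \<and> ?g \<beta> = \<mu>. of_int (shat_composition r \<beta>) *\<^sub>Q complete_hom_list \<beta>) =
        (\<Sum>\<beta> | \<beta> \<in> compositions m \<and> ?g \<beta> = \<mu>. of_int (shat_composition r \<beta>) *\<^sub>Q complete_hom_list \<mu>)"
      by (rule sum.cong) (auto intro!: arg_cong[where f = "scale_mpseries _"] complete_hom_list_cong_mset)
    then show "(\<Sum>\<beta> | \<beta> \<in> compositions m \<and> ?g \<beta> = \<mu>. of_int (shat_composition r \<beta>) *\<^sub>Q complete_hom_list \<beta>) =
        of_int (shat_partition r \<mu>) *\<^sub>Q complete_hom_list \<mu>"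
      by (simp add: shat_partition_def m scale_sum_left)
  qed
  finally show ?thesis .
qed

section \<open>Both expansions, with uniqueness of the coefficients indexed by partitions\<close>

theorem corollary51:
  fixes n r :: nat
  assumes "n > 0" and "r > 0"
  shows "(plethysm_power_sum (complete_hom n) r =
      (\<Sum>\<beta> \<in> compositions (n * r). of_int (shat_composition r \<beta>) *\<^sub>Q complete_hom_list \<beta>)) \<and>
    (\<forall>c :: nat list \<Rightarrow> rat.
      plethysm_power_sum (complete_hom n) r =
        (\<Sum>\<mu> \<in> partitions (n * r). c \<mu> *\<^sub>Q complete_hom_list \<mu>)
      \<longleftrightarrow> (\<forall>\<mu> \<in> partitions (n * r). c \<mu> = of_int (shat_partition r \<mu>)))"
proof (intro conjI allI iffI)
  show compositions: "plethysm_power_sum (complete_hom n) r =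
      (\<Sum>\<beta> \<in> compositions (n * r). of_int (shat_composition r \<beta>) *\<^sub>Q complete_hom_list \<beta>)"
    using assms
    by (simp add: plethysm_power_sum_hom_eq_signed_hom_sum sum_shat_composition_eq_signed_hom_sum)
  note partitions = compositions[unfolded sum_shat_composition_eq_sum_shat_partition]
  fix c :: "nat list \<Rightarrow> rat"
  show "\<forall>\<mu> \<in> partitions (n * r). c \<mu> = of_int (shat_partition r \<mu>)"
    if "plethysm_power_sum (complete_hom n) r =
      (\<Sum>\<mu> \<in> partitions (n * r). c \<mu> *\<^sub>Q complete_hom_list \<mu>)"
  proof
    fix \<mu> assume \<mu>: "\<mu> \<in> partitions (n * r)"
    \<comment> \<open>The difference of two expansions of the same series is a linear
      relation.\<close>
    have "(\<Sum>\<mu> \<in> partitions (n * r). (c \<mu> - of_int (shat_partition r \<mu>)) *\<^sub>Q complete_hom_list \<mu>) = 0"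
      using that partitions by (simp add: scale_diff sum_subtractf)
    from complete_hom_list_independent[OF this \<mu>] show "c \<mu> = of_int (shat_partition r \<mu>)" by simp
  qed
  show "plethysm_power_sum (complete_hom n) r =
      (\<Sum>\<mu> \<in> partitions (n * r). c \<mu> *\<^sub>Q complete_hom_list \<mu>)"
    if "\<forall>\<mu> \<in> partitions (n * r). c \<mu> = of_int (shat_partition r \<mu>)"
    unfolding partitions by (rule sum.cong) (use that in auto)
qed

end
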